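(* Let $(\boldsymbol{x},\tau_h)$ be a random pair with law $\mathcal{D}$ on $\mathbb{R}^d\times\mathbb{R}$, let $f_x:\mathbb{R}^d\to\mathbb{R}$ be a (measurable) estimation model, and put $\hat{\tau}_h=f_x(\boldsymbol{x})$. Suppose that the estimation error $\tau_h-\hat{\tau}_h$ follows a normal distribution $\mathcal{N}(0,\sigma^2)$ with $\sigma>0$, and that the generalization error $L_{\mathcal{D}}=\mathbb{E}\left(|\tau_h-\hat{\tau}_h|\right)$ satisfies $L_{\mathcal{D}}\leq L_{\mathcal{B}^*}$ for a real number $L_{\mathcal{B}^*}$. Let $T_{dz}>0$ and let the robot's desired torque $\tau_r$ be obtained from $\hat{\tau}_h$ by the dead-zone mechanism with threshold $T_{dz}$. Then the matched assistance probability satisfies $$P(M_a)\;\geq\;2\,\Phi\!\left(\sqrt{\frac{2}{\pi}}\,\frac{T_{dz}}{L_{\mathcal{B}^*}}\right)-1,$$ where $\Phi$ is the standard normal cumulative distribution function.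
   Context: Here $\boldsymbol{x}$ is the input (EMG) signal, $\tau_h$ is the real human torque, and $\hat{\tau}_h=f_x(\boldsymbol{x})$ is the estimated human torque; probabilities and expectations are with respect to the law $\mathcal{D}$ of $(\boldsymbol{x},\tau_h)$. Dead-zone mechanism with threshold $T_{dz}>0$: the desired robot torque $\tau_r=\tau_r(\boldsymbol{x})$ is $$\tau_r=\begin{cases}\hat{\tau}_h-\operatorname{sign}(\hat{\tau}_h)\,T_{dz}, & \text{if } |\hat{\tau}_h|\geq T_{dz},\\ 0,&\text{otherwise.}\end{cases}$$ Matched assistance: $M_a$ is the event that $\tau_r(\boldsymbol{x})\cdot\tau_h\geq 0$ and $|\tau_r(\boldsymbol{x})|\leq|\tau_h|$. The matched assistance probability is $P(M_a)=P\left((\boldsymbol{x},\tau_h)\in M_a\right)$. $L_{\mathcal{B}^*}$ denotes an upper bound on the generalization error $L_{\mathcal{D}}$; it is treated as a fixed constant. *)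

theory Defs
  imports "HOL-Probability.Probability"
begin

definition dead_zone :: "real \<Rightarrow> real \<Rightarrow> real" where
  "dead_zone T u = (if \<bar>u\<bar> \<ge> T then u - sgn u * T else 0)"

definition robot_torque :: "('x \<Rightarrow> real) \<Rightarrow> real \<Rightarrow> 'x \<Rightarrow> real" where
  "robot_torque f T x = dead_zone T (f x)"

definition matched_assistance :: "('x \<Rightarrow> real) \<Rightarrow> real \<Rightarrow> ('x \<times> real) set" where
  "matched_assistance f T =
     {(x, t). robot_torque f T x * t \<ge> 0 \<and> \<bar>robot_torque f T x\<bar> \<le> \<bar>t\<bar>}"

definition generalization_error :: "('x \<times> real) measure \<Rightarrow> ('x \<Rightarrow> real) \<Rightarrow> real" where
  "generalization_error D f = (\<integral>z. \<bar>snd z - f (fst z)\<bar> \<partial>D)"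

definition std_normal_cdf :: "real \<Rightarrow> real" where
  "std_normal_cdf = cdf std_normal_distribution"

end

theory Submission
  imports Defs
begin

text \<open>
  If the estimation error e is at most T in absolute value, then the assistance is matched: the
  dead zone moves the estimate by T towards zero, hence never beyond the real torque. So the
  matched assistance probability is at least the probability of \<open>\<bar>e\<bar> \<le> T\<close>, which is
  \<open>2 \<Phi>(T / \<sigma>) - 1\<close>. Since \<open>\<bar>e\<bar>\<close> has mean \<open>\<sigma> sqrt (2 / \<pi>)\<close>, the bound
  on the generalization error bounds \<open>\<sigma>\<close> from above.
\<close>

lemma matched_assistance_if_error_le:
  assumes "T > 0" "\<bar>t - f x\<bar> \<le> T"
  shows "(x, t) \<in> matched_assistance f T"
proof -
  \<comment> \<open>In the first case the robot torque is \<open>f x - T\<close>, which is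
    nonnegative and at most \<open>t\<close> by the error bound; the second case is its mirror
    image, and in the third the robot torque is 0.\<close>
  consider "f x \<ge> T" | "f x \<le> - T" | "\<bar>f x\<bar> < T"
    by linarith
  then show ?thesis
    using assms
    by cases (auto simp: matched_assistance_def robot_torque_def dead_zone_def sgn_if
        intro: mult_nonpos_nonpos)
qed

lemma dead_zone_measurable [measurable]: "dead_zone T \<in> borel_measurable borel"
  unfolding dead_zone_def[abs_def] by measurable

text \<open>The affine map with factor -1 and shift 0 sends the standard normal law to itself, and
  the preimage of the left tail under negation is the right tail.\<close>

lemma std_normal_measure_symmetric:
  "measure std_normal_distribution {..<- a} = measure std_normal_distribution {a<..}"
proof -
  interpret real_distribution std_normal_distribution
    by (rule real_dist_normal_dist)
  have "distributed std_normal_distribution lborel (\<lambda>x. x) std_normal_density"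
    by (auto simp: distributed_def intro!: distr_id2)
  from normal_density_affine[OF this, of "-1" 0]
  have "distr std_normal_distribution lborel uminus = std_normal_distribution"
    by (auto simp: distributed_def fun_Compl_def)
  then have "measure std_normal_distribution {..<- a}
      = measure (distr std_normal_distribution lborel uminus) {..<- a}"
    by simp
  also have "\<dots> = measure std_normal_distribution {a<..}"
    by (subst measure_distr) (auto intro!: arg_cong[where f = "measure _"])
  finally show ?thesis .
qed

text \<open>Both tails have mass 1 - \<Phi>(a), so cutting the left one off \<open>{..a}\<close>
  leaves \<Phi>(a) - (1 - \<Phi>(a)).\<close>

lemma std_normal_measure_centered:
  assumes "a \<ge> 0"
  shows "measure std_normal_distribution {- a..a} = 2 * std_normal_cdf a - 1"
proof -
  interpret real_distribution std_normal_distribution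
    by (rule real_dist_normal_dist)
  have tail: "measure std_normal_distribution {a<..} = 1 - std_normal_cdf a"
    using prob_compl[of "{..a}"]
    by (simp add: std_normal_cdf_def cdf_def Compl_atMost flip: Compl_eq_Diff_UNIV)
  have "{..a} = {..<- a} \<union> {- a..a}" "{..<- a} \<inter> {- a..a} = {}"
    using assms by auto
  then have "std_normal_cdf a
      = measure std_normal_distribution {..<- a} + measure std_normal_distribution {- a..a}"
    by (simp add: std_normal_cdf_def cdf_def finite_measure_Union)
  then show ?thesis
    using tail std_normal_measure_symmetric[of a] by simp
qed

context prob_space
begin

text \<open>This is the lowest case of the odd absolute moments of a normal law, and the source of
  the constant \<open>sqrt (2 / pi)\<close>.\<close>

lemma expectation_abs_normal:
  assumes "distributed M lborel X (normal_density 0 \<sigma>)" "\<sigma> > 0"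
  shows "expectation (\<lambda>\<omega>. \<bar>X \<omega>\<bar>) = \<sigma> * sqrt (2 / pi)"
  using distributed_integral[OF assms(1), of abs] integral_normal_moment_abs_odd[of \<sigma> 0 0] assms(2)
  by simp

lemma prob_abs_normal_le:
  assumes X: "distributed M lborel X (normal_density 0 \<sigma>)" and "\<sigma> > 0" "T \<ge> 0"
  shows "prob {\<omega> \<in> space M. \<bar>X \<omega>\<bar> \<le> T} = 2 * std_normal_cdf (T / \<sigma>) - 1"
proof -
  have Z: "distributed M lborel (\<lambda>\<omega>. X \<omega> / \<sigma>) std_normal_density"
    using normal_standard_normal_convert[of \<sigma> X 0] assms by simp
  then have [measurable]: "(\<lambda>\<omega>. X \<omega> / \<sigma>) \<in> borel_measurable M"
    and law: "distr M lborel (\<lambda>\<omega>. X \<omega> / \<sigma>) = std_normal_distribution"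
    by (auto simp: distributed_def)
  \<comment> \<open>Standardizing by \<sigma> > 0 turns the error bound into membership in a
    symmetric interval.\<close>
  have "{\<omega> \<in> space M. \<bar>X \<omega>\<bar> \<le> T} = (\<lambda>\<omega>. X \<omega> / \<sigma>) -` {- (T / \<sigma>)..T / \<sigma>} \<inter> space M"
    using \<open>\<sigma> > 0\<close> by (auto simp: field_simps abs_le_iff)
  then have "prob {\<omega> \<in> space M. \<bar>X \<omega>\<bar> \<le> T}
      = measure (distr M lborel (\<lambda>\<omega>. X \<omega> / \<sigma>)) {- (T / \<sigma>)..T / \<sigma>}"
    by (subst measure_distr) auto
  also have "\<dots> = 2 * std_normal_cdf (T / \<sigma>) - 1"
    unfolding law using assms by (intro std_normal_measure_centered) simp
  finally show ?thesis .
qed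

end

theorem theorem1:
  fixes M :: "'a measure"
    and x :: "'a \<Rightarrow> real ^ 'd"
    and \<tau>h :: "'a \<Rightarrow> real"
    and D :: "((real ^ 'd) \<times> real) measure"
    and f :: "real ^ 'd \<Rightarrow> real"
    and \<sigma> L T :: real
  assumes "prob_space M"
    and "x \<in> borel_measurable M"
    and "\<tau>h \<in> borel_measurable M"
    and "D = distr M borel (\<lambda>\<omega>. (x \<omega>, \<tau>h \<omega>))"
    and "f \<in> borel_measurable borel"
    and "\<sigma> > 0"
    and "distributed M lborel (\<lambda>\<omega>. \<tau>h \<omega> - f (x \<omega>)) (normal_density 0 \<sigma>)"
    and "generalization_error D f \<le> L"
    and "T > 0"
  shows "\<P>(\<omega> in M. (x \<omega>, \<tau>h \<omega>) \<in> matched_assistance f T)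
           \<ge> 2 * std_normal_cdf (sqrt (2 / pi) * (T / L)) - 1"
proof -
  interpret prob_space M
    by fact
  note [measurable] = assms(2,3,5)
  \<comment> \<open>Integration against the law \<open>D\<close> is pulled back to \<open>M\<close>;
    splitting the Borel sets of the product into a product of Borel sets gives measurability of the
    integrand.\<close>
  have "generalization_error D f = expectation (\<lambda>\<omega>. \<bar>\<tau>h \<omega> - f (x \<omega>)\<bar>)"
    unfolding generalization_error_def \<open>D = _\<close> by (subst integral_distr) (simp_all flip: borel_prod)
  also have "\<dots> = \<sigma> * sqrt (2 / pi)"
    using assms(7) \<open>\<sigma> > 0\<close> by (rule expectation_abs_normal)
  finally have L: "\<sigma> * sqrt (2 / pi) \<le> L"
    using assms(8) by simp
  \<comment> \<open>A strictly positive mean error forces L > 0, so T / L is a genuine quotient and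
    denominators can be cleared below.\<close>
  moreover have "0 < \<sigma> * sqrt (2 / pi)"
    using \<open>\<sigma> > 0\<close> by simp
  ultimately have "L > 0"
    by linarith
  have "sqrt (2 / pi) * (T / L) \<le> T / \<sigma>"
    using mult_right_mono[OF L, of T] \<open>L > 0\<close> \<open>\<sigma> > 0\<close> \<open>T > 0\<close>
    by (simp add: divide_simps ac_simps)
  then have "std_normal_cdf (sqrt (2 / pi) * (T / L)) \<le> std_normal_cdf (T / \<sigma>)"
    unfolding std_normal_cdf_def
    using real_dist_normal_dist
    by (intro finite_borel_measure.cdf_nondecreasing
        real_distribution.finite_borel_measure_M)
  then have "2 * std_normal_cdf (sqrt (2 / pi) * (T / L)) - 1
      \<le> 2 * std_normal_cdf (T / \<sigma>) - 1"
    by simp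
  also have "\<dots> = prob {\<omega> \<in> space M. \<bar>\<tau>h \<omega> - f (x \<omega>)\<bar> \<le> T}"
    using prob_abs_normal_le[OF assms(7)] \<open>\<sigma> > 0\<close> \<open>T > 0\<close> by simp
  also have "\<dots> \<le> \<P>(\<omega> in M. (x \<omega>, \<tau>h \<omega>) \<in> matched_assistance f T)"
  \<comment> \<open>Small errors imply matched assistance; monotonicity also requires the larger
    event to be measurable.\<close>
  proof (rule finite_measure_mono)
    show "{\<omega> \<in> space M. (x \<omega>, \<tau>h \<omega>) \<in> matched_assistance f T} \<in> events"
      unfolding matched_assistance_def robot_torque_def prod.case mem_Collect_eq
      by measurable
  qed (use matched_assistance_if_error_le[OF \<open>T > 0\<close>] in auto)
  finally show ?thesis .
qed

end
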